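(* For every integer $n\geq 1$, there exists a finite subset $M_n\subset\mathbb{Z}^n$ with $0\in M_n$ such that, when $M_n$ is equipped with the metric $d(x,y)=\|x-y\|_\infty$ inherited from $\ell_\infty^n$ and with base point $0$, the Lipschitz-free space $\mathcal{F}(M_n)$ contains a linear isometric copy of $\ell_\infty^n$. In fact, there exist elements $u_1,\dotsc,u_n\in\mathcal{F}(M_n)$ such that \[ \Big\|\sum_{i=1}^n t_i u_i\Big\|_{\mathcal{F}(M_n)}=\max_{1\leq i\leq n}|t_i|\qquad\text{for all } t_1,\dotsc,t_n\in\mathbb{R}. \]
   Context: All Banach spaces are real. $\ell_\infty^n$ denotes $\mathbb{R}^n$ with the norm $\|x\|_\infty=\max_{1\leq i\leq n}|x_i|$. For a metric space $(M,d)$ with a distinguished base point $0\in M$, $\operatorname{Lip}_0(M)$ denotes the Banach space of all Lipschitz functions $f\colon M\to\mathbb{R}$ with $f(0)=0$, normed by the best Lipschitz constant $\|f\|_{\operatorname{Lip}}=\sup_{x\neq y}\frac{|f(x)-f(y)|}{d(x,y)}$. For $x\in M$ let $\delta_x\in\operatorname{Lip}_0(M)^*$ be the evaluation functional $\delta_x(f)=f(x)$ (so $\delta_0=0$). The Lipschitz-free space $\mathcal{F}(M)$ is the norm-closed linear span of $\{\delta_x: x\in M\}$ in $\operatorname{Lip}_0(M)^*$, with the dual norm; thus for $\mu\in\mathcal{F}(M)$, $\|\mu\|=\sup\{|\langle\mu,f\rangle| : f\in\operatorname{Lip}_0(M),\ \|f\|_{\operatorname{Lip}}\leq 1\}$.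 If $M$ is finite, $\mathcal{F}(M)$ is simply the linear span of the $\delta_x$, and has dimension $|M|-1$. A Banach space $Y$ contains a linear isometric copy of $X$ if there is a linear map $T\colon X\to Y$ with $\|Tx\|=\|x\|$ for all $x\in X$. *)

theory Defs
  imports "HOL-Analysis.Analysis" "HOL-Library.Function_Algebras"
begin

text \<open>Real-valued functions form a real vector space under the pointwise operations; together with
  \<open>Function_Algebras\<close> this makes \<open>span\<close>, \<open>subspace\<close>, \<open>linear\<close> and finite sums available for
  Lipschitz functions and for functionals on them.\<close>

instantiation "fun" :: (type, real_vector) real_vector
begin

definition scaleR_fun :: "real \<Rightarrow> ('a \<Rightarrow> 'b) \<Rightarrow> 'a \<Rightarrow> 'b" where
  "scaleR_fun c f = (\<lambda>x. c *\<^sub>R f x)"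

instance
  by standard (simp_all add: scaleR_fun_def fun_eq_iff scaleR_add_right scaleR_add_left)

end

lemma scaleR_fun_apply [simp]: "(c *\<^sub>R f) x = c *\<^sub>R f x"
  by (simp add: scaleR_fun_def)

text \<open>Functions on the points of \<open>m\<close> are represented by total functions that vanish outside
  \<open>mspace m\<close>, so that equality in \<open>Lip0 m z\<close> is equality on \<open>mspace m\<close>. The base point is \<open>z\<close>.\<close>

definition Lip0 :: "'a metric \<Rightarrow> 'a \<Rightarrow> ('a \<Rightarrow> real) set" where
  "Lip0 m z = {f. Lipschitz_continuous_map m euclidean_metric f \<and> f z = 0 \<and>
                  (\<forall>x. x \<notin> mspace m \<longrightarrow> f x = 0)}"

text \<open>The element 0 is inserted so that the supremum is 0 when \<open>m\<close> has only one point.\<close>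

definition lip_norm :: "'a metric \<Rightarrow> ('a \<Rightarrow> real) \<Rightarrow> real" where
  "lip_norm m f =
     Sup (insert 0 {\<bar>f x - f y\<bar> / mdist m x y | x y. x \<in> mspace m \<and> y \<in> mspace m \<and> x \<noteq> y})"

text \<open>The dual space of \<open>Lip0 m z\<close>: functionals are represented by total functions vanishing
  outside \<open>Lip0 m z\<close>, so that equality of functionals is equality on \<open>Lip0 m z\<close>.\<close>

definition Lip0_dual :: "'a metric \<Rightarrow> 'a \<Rightarrow> (('a \<Rightarrow> real) \<Rightarrow> real) set" where
  "Lip0_dual m z = {\<phi>.
     (\<forall>f\<in>Lip0 m z. \<forall>g\<in>Lip0 m z. \<phi> (f + g) = \<phi> f + \<phi> g) \<and>
     (\<forall>c. \<forall>f\<in>Lip0 m z. \<phi> (c *\<^sub>R f) = c * \<phi> f) \<and>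
     (\<exists>C. \<forall>f\<in>Lip0 m z. \<bar>\<phi> f\<bar> \<le> C * lip_norm m f) \<and>
     (\<forall>f. f \<notin> Lip0 m z \<longrightarrow> \<phi> f = 0)}"

definition dual_norm :: "'a metric \<Rightarrow> 'a \<Rightarrow> (('a \<Rightarrow> real) \<Rightarrow> real) \<Rightarrow> real" where
  "dual_norm m z \<phi> = Sup {\<bar>\<phi> f\<bar> | f. f \<in> Lip0 m z \<and> lip_norm m f \<le> 1}"

definition eval_functional :: "'a metric \<Rightarrow> 'a \<Rightarrow> 'a \<Rightarrow> ('a \<Rightarrow> real) \<Rightarrow> real" where
  "eval_functional m z x = (\<lambda>f. if f \<in> Lip0 m z then f x else 0)"

definition free_space :: "'a metric \<Rightarrow> 'a \<Rightarrow> (('a \<Rightarrow> real) \<Rightarrow> real) set" where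
  "free_space m z = {\<mu> \<in> Lip0_dual m z.
     \<forall>\<epsilon>>0. \<exists>\<nu> \<in> span (eval_functional m z ` mspace m). dual_norm m z (\<mu> - \<nu>) < \<epsilon>}"

text \<open>The domain is the whole type, normed by \<open>nX\<close>; the target is the subspace \<open>Y\<close>, normed by \<open>nY\<close>.\<close>

definition contains_isometric_copy ::
  "('v::real_vector \<Rightarrow> real) \<Rightarrow> 'w::real_vector set \<Rightarrow> ('w \<Rightarrow> real) \<Rightarrow> bool" where
  "contains_isometric_copy nX Y nY \<longleftrightarrow>
     (\<exists>T. linear T \<and> range T \<subseteq> Y \<and> (\<forall>x. nY (T x) = nX x))"

definition linf_metric :: "(real ^ 'n) metric" where
  "linf_metric = metric (UNIV, \<lambda>x y. infnorm (x - y))"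

lemma Metric_space_infnorm: "Metric_space (UNIV :: (real ^ 'n) set) (\<lambda>x y. infnorm (x - y))"
proof
  fix x y z :: "real ^ 'n"
  show "infnorm (x - z) \<le> infnorm (x - y) + infnorm (y - z)"
    using infnorm_triangle[of "x - y" "y - z"] by simp
qed (auto simp: infnorm_pos_le infnorm_sub infnorm_eq_0)

lemma mspace_linf_metric [simp]: "mspace linf_metric = UNIV"
  unfolding linf_metric_def by (rule Metric_space.mspace_metric[OF Metric_space_infnorm])

lemma mdist_linf_metric [simp]: "mdist linf_metric x y = infnorm (x - y)"
  unfolding linf_metric_def by (simp add: Metric_space.mdist_metric[OF Metric_space_infnorm])

lemma infnorm_eq_Max_cart: "infnorm (x :: real ^ 'n) = Max (range (\<lambda>i. \<bar>x $ i\<bar>))"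
proof -
  have "{\<bar>x $ i\<bar> |i. i \<in> UNIV} = range (\<lambda>i. \<bar>x $ i\<bar>)"
    by auto
  then show ?thesis
    by (simp add: infnorm_cart cSup_eq_Max)
qed

end

theory Submission
  imports Defs
begin

text \<open>
  A functional on \<open>Lip0\<close> of a box of lattice points is a finite combination of evaluations, so it suffices
  to find functionals \<open>u i\<close> with \<open>(\<Sum>i. \<bar>u i f\<bar>) \<le> 1\<close> for every 1-Lipschitz \<open>f\<close> and \<open>u i\<close> equal
  to 1 on the \<open>i\<close>-th coordinate function. A differentiable 1-Lipschitz function on \<open>\<ell>\<^sub>\<infinity>\<close> has a gradient
  of \<open>\<ell>\<^sub>1\<close>-norm at most 1, so partial derivatives at a point would do, if \<open>f\<close> could be extended
  linearly to such a function. The extension by a box spline with directions \<open>v \<in> {-1,0,1}\<^sup>n\<close> does this: its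
  derivative along \<open>v\<close> is an average of the differences \<open>f (k + v) - f k\<close>.

  Here the box spline is discretised. Let \<open>g y = f \<lfloor>y / N\<rfloor>\<close> on the lattice and let \<open>F\<close> be the mean of \<open>g\<close>
  over \<open>y + (\<Sum>v. a\<^sub>v v)\<close> with \<open>0 \<le> a\<^sub>v < N\<close>, where each direction is taken twice. Telescoping shows that
  the differences of \<open>F\<close> along directions are at most \<open>1 / N\<close> and its mixed second differences
  are \<open>O(1 / N\<^sup>2)\<close>. Hence \<open>f \<mapsto> N (F e\<^sub>i - F 0)\<close> are as required up to an error \<open>O(1 / N)\<close>. They live on a
  box that does not depend on \<open>N\<close>, so a subsequence converges.
\<close>

section \<open>Averaging along a list of directions\<close>

text \<open>Directions form a list so that one may occur several times. In the ring
  \<open>int ^ 'n\<close>, multiplication is componentwise and \<open>of_nat a\<close> is a constant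
  vector, so \<open>of_nat a * v\<close> is the multiple of \<open>v\<close> by
  \<open>a\<close>.\<close>

fun avg :: "nat \<Rightarrow> 'a::comm_ring_1 list \<Rightarrow> ('a \<Rightarrow> real) \<Rightarrow> 'a \<Rightarrow> real" where
  "avg N [] g x = g x"
| "avg N (v # vs) g x = (\<Sum>a<N. avg N vs g (x + of_nat a * v)) / real N"

lemma avg_shift: "avg N vs (\<lambda>y. g (y + w)) x = avg N vs g (x + w)"
  by (induction vs arbitrary: x) (simp_all add: algebra_simps)

lemma avg_diff: "avg N vs (\<lambda>y. g y - h y) x = avg N vs g x - avg N vs h x"
  by (induction vs arbitrary: x) (simp_all add: sum_subtractf diff_divide_distrib)

lemma avg_cmult: "avg N vs (\<lambda>y. c * g y) x = c * avg N vs g x"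
  by (induction vs arbitrary: x) (simp_all flip: sum_distrib_left)

lemma avg_sum: "avg N vs (\<lambda>y. \<Sum>k\<in>K. g k y) x = (\<Sum>k\<in>K. avg N vs (g k) x)"
proof (induction vs arbitrary: x)
  case (Cons v vs)
  then show ?case
    by (simp add: sum_divide_distrib sum.swap[of _ K])
qed simp

lemma avg_const: "N > 0 \<Longrightarrow> avg N vs (\<lambda>y. c) x = c"
  by (induction vs arbitrary: x) simp_all

lemma avg_bound:
  assumes "N > 0" "\<And>y. \<bar>g y\<bar> \<le> c"
  shows "\<bar>avg N vs g x\<bar> \<le> c"
proof (induction vs arbitrary: x)
  case (Cons v vs)
  have "\<bar>\<Sum>a<N. avg N vs g (x + of_nat a * v)\<bar> \<le> (\<Sum>a<N. c)"
    by (rule order_trans[OF sum_abs sum_mono]) (rule Cons.IH)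
  then show ?case
    using assms(1) by (simp add: field_simps)
qed (use assms in simp)

text \<open>Averages along different directions commute, so one occurrence of \<open>v\<close> can
  be made the outermost average; \<open>remove1\<close> leaves any further copies in place.\<close>

lemma avg_remove1:
  assumes "v \<in> set vs"
  shows "avg N vs g x = (\<Sum>a<N. avg N (remove1 v vs) g (x + of_nat a * v)) / real N"
  using assms
proof (induction vs arbitrary: x)
  case (Cons w vs)
  show ?case
  proof (cases "v = w")
    case False
    then have "avg N (w # vs) g x
        = (\<Sum>b<N. (\<Sum>a<N. avg N (remove1 v vs) g (x + of_nat b * w + of_nat a * v)) / real N) / real N"
      using Cons by simp
    also have "\<dots> = (\<Sum>a<N. (\<Sum>b<N. avg N (remove1 v vs) g (x + of_nat a * v + of_nat b * w)) / real N) / real N"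
      unfolding sum_divide_distrib by (subst sum.swap) (simp add: add_ac)
    finally show ?thesis
      using False by simp
  qed simp
qed simp

text \<open>Moving by \<open>v\<close> shifts the summation index of that direction by one, so the
  sum telescopes to its terms at \<open>N\<close> and at 0. A unit step of the average thus becomes
  a step of length \<open>N\<close> in \<open>g\<close>, with a factor \<open>1 / N\<close>.\<close>

lemma avg_step:
  assumes "v \<in> set vs"
  shows "avg N vs g (x + v) - avg N vs g x
    = avg N (remove1 v vs) (\<lambda>y. g (y + of_nat N * v) - g y) x / real N"
proof -
  define h where "h a = avg N (remove1 v vs) g (x + of_nat a * v)" for a
  have "avg N vs g (x + v) - avg N vs g x = (\<Sum>a<N. h (Suc a) - h a) / real N"
    unfolding avg_remove1[OF assms, of N g] h_def
    by (simp add: sum_subtractf diff_divide_distrib algebra_simps)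
  also have "\<dots> = (h N - h 0) / real N"
    by (simp add: sum_lessThan_telescope)
  finally show ?thesis
    by (simp add: h_def avg_diff avg_shift)
qed

lemma avg_step_bound:
  assumes "N > 0" "v \<in> set vs" "\<And>y. \<bar>g (y + of_nat N * v) - g y\<bar> \<le> c"
  shows "\<bar>avg N vs g (x + v) - avg N vs g x\<bar> \<le> c / real N"
proof -
  have "\<bar>avg N (remove1 v vs) (\<lambda>y. g (y + of_nat N * v) - g y) x\<bar> \<le> c"
    by (rule avg_bound[OF assms(1)]) (rule assms(3))
  then show ?thesis
    unfolding avg_step[OF assms(2)] abs_divide abs_of_nat
    by (rule divide_right_mono) (rule of_nat_0_le_iff)
qed

text \<open>The first difference along \<open>v\<close> is itself an average over the remaining
  list. That list still contains \<open>w\<close>, so telescoping applies once more; for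
  \<open>w = v\<close> this takes two copies of \<open>v\<close>.\<close>

lemma avg_second_step_bound:
  assumes N: "N > 0" and v: "v \<in> set vs" and w: "w \<in> set (remove1 v vs)"
    and g: "\<And>y. \<bar>g (y + of_nat N * v) - g y\<bar> \<le> c"
  shows "\<bar>(avg N vs g (x + w + v) - avg N vs g (x + w)) - (avg N vs g (x + v) - avg N vs g x)\<bar>
    \<le> 2 * c / (real N)\<^sup>2"
proof -
  let ?h = "\<lambda>y. g (y + of_nat N * v) - g y"
  have "\<bar>?h (y + of_nat N * w) - ?h y\<bar> \<le> 2 * c" for y
    using g[of "y + of_nat N * w"] g[of y] by linarith
  from avg_step_bound[where g = ?h, OF N w this]
  have "\<bar>avg N (remove1 v vs) ?h (x + w) - avg N (remove1 v vs) ?h x\<bar> / real N \<le> 2 * c / real N / real N"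
    by (rule divide_right_mono) simp
  then show ?thesis
    unfolding avg_step[OF v]
    by (simp add: power2_eq_square flip: diff_divide_distrib)
qed

text \<open>Each direction moves a coordinate by at most \<open>N\<close>, so the average only sees
  points within \<open>N * length vs\<close> of \<open>x\<close>. This serves to remove the clamp
  for coordinate functions.\<close>

lemma avg_cong_near:
  fixes x :: "int ^ 'n"
  assumes "\<And>v i. v \<in> set vs \<Longrightarrow> \<bar>v $ i\<bar> \<le> 1"
    and "\<And>y. (\<And>i. \<bar>y $ i - x $ i\<bar> \<le> int N * int (length vs)) \<Longrightarrow> g y = h y"
  shows "avg N vs g x = avg N vs h x"
  using assms
proof (induction vs arbitrary: x)
  case Nil
  then show ?case by simp
next
  case (Cons v vs)
  have "avg N vs g (x + of_nat a * v) = avg N vs h (x + of_nat a * v)" if a: "a < N" for a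
  proof (rule Cons.IH)
    fix y :: "int ^ 'n"
    assume y: "\<And>i. \<bar>y $ i - (x + of_nat a * v) $ i\<bar> \<le> int N * int (length vs)"
    have "\<bar>y $ i - x $ i\<bar> \<le> int N * int (length (v # vs))" for i
    proof -
      have "\<bar>int a * v $ i\<bar> \<le> int N * 1"
        unfolding abs_mult using a Cons.prems(1)[of v i] by (intro mult_mono) auto
      then show ?thesis
        using y[of i] by (simp add: algebra_simps of_nat_index)
    qed
    then show "g y = h y"
      by (rule Cons.prems(2))
  qed (use Cons.prems(1) in auto)
  then show ?case by simp
qed

section \<open>Almost linear functions on the lattice\<close>

definition unit_box :: "(int ^ 'n) set" where
  "unit_box = {v. \<forall>i. v $ i \<in> {-1, 0, 1}}"

lemma finite_vec_set:
  assumes "finite A"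
  shows "finite {x :: 'a ^ 'n. \<forall>i. x $ i \<in> A}"
proof (rule finite_subset)
  show "{x. \<forall>i. x $ i \<in> A} \<subseteq> vec_lambda ` (UNIV \<rightarrow>\<^sub>E A :: ('n \<Rightarrow> 'a) set)"
    by (auto intro!: image_eqI[where x = "vec_nth _"])
  show "finite (vec_lambda ` (UNIV \<rightarrow>\<^sub>E A :: ('n \<Rightarrow> 'a) set))"
    using assms by (intro finite_imageI finite_PiE) auto
qed

lemma finite_unit_box: "finite (unit_box :: (int ^ 'n) set)"
  unfolding unit_box_def by (rule finite_vec_set) simp

lemma axis_in_unit_box: "axis i 1 \<in> unit_box"
  by (simp add: unit_box_def axis_def)

text \<open>Coordinates are switched on one at a time. By the bound on mixed differences, the change
  of \<open>F\<close> at each switch agrees with the change at the origin up to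
  \<open>d\<close>.\<close>

lemma almost_linear:
  fixes F :: "int ^ 'n \<Rightarrow> real" and s :: "'n \<Rightarrow> int"
  assumes F: "\<And>v w x. v \<in> unit_box \<Longrightarrow> w \<in> unit_box \<Longrightarrow>
      \<bar>(F (x + w + v) - F (x + w)) - (F (x + v) - F x)\<bar> \<le> d"
    and s: "\<And>i. s i \<in> {-1, 1}"
    and "finite S"
  shows "\<bar>F (\<chi> j. if j \<in> S then s j else 0) - F 0
      - (\<Sum>i\<in>S. of_int (s i) * (F (axis i 1) - F 0))\<bar> \<le> real (card S) * d"
  using \<open>finite S\<close>
proof (induction S rule: finite_induct)
  case empty
  have "(\<chi> j. 0) = (0 :: int ^ 'n)"
    by (simp add: vec_eq_iff)
  then show ?case by simp
next
  case (insert i S)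
  define p :: "int ^ 'n" where "p = (\<chi> j. if j \<in> S then s j else 0)"
  define q :: "int ^ 'n" where "q = (\<chi> j. if j \<in> insert i S then s j else 0)"
  have pq: "p \<in> unit_box" "q \<in> unit_box"
    using s by (auto simp: p_def q_def unit_box_def)
  have step: "\<bar>F q - F p - of_int (s i) * (F (axis i 1) - F 0)\<bar> \<le> d"
  proof (cases "s i = 1")
    case True
    then have "q = p + axis i 1"
      using insert.hyps by (auto simp: p_def q_def vec_eq_iff axis_def)
    then show ?thesis
      using F[OF axis_in_unit_box pq(1), of 0 i] True by simp
  next
    case False
    then have si: "s i = -1"
      using s[of i] by simp
    \<comment> \<open>For a negative sign the unit step leads from \<open>q\<close> back to
      \<open>p\<close>, so the same estimate is used with base point \<open>q\<close>.\<close>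
    then have "p = q + axis i 1"
      using insert.hyps by (auto simp: p_def q_def vec_eq_iff axis_def)
    then show ?thesis
      using F[OF axis_in_unit_box pq(2), of 0 i] si by simp
  qed
  have "\<bar>F p - F 0 - (\<Sum>i\<in>S. of_int (s i) * (F (axis i 1) - F 0))\<bar> \<le> real (card S) * d"
    using insert.IH by (simp add: p_def)
  with step have "\<bar>F q - F 0 - (\<Sum>i\<in>insert i S. of_int (s i) * (F (axis i 1) - F 0))\<bar>
      \<le> real (card S) * d + d"
    using insert.hyps by simp
  then show ?case
    using insert.hyps by (simp add: q_def algebra_simps)
qed

section \<open>Difference functionals on a box of lattice points\<close>

definition grid :: "int \<Rightarrow> (real ^ 'n) set" where
  "grid R = {x. \<forall>i. x $ i \<in> real_of_int ` {-R..R}}"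

lemma finite_grid: "finite (grid R :: (real ^ 'n) set)"
  unfolding grid_def by (rule finite_vec_set) simp

lemma zero_in_grid: "R \<ge> 0 \<Longrightarrow> 0 \<in> grid R"
  by (force simp: grid_def)

text \<open>Clamping to the box is nonexpansive and maps lattice points to lattice points, so a function on the box can be read as a function on the
  whole lattice with the same Lipschitz constant.\<close>

definition cell :: "int \<Rightarrow> nat \<Rightarrow> int ^ 'n \<Rightarrow> real ^ 'n" where
  "cell R N y = (\<chi> i. of_int (max (-R) (min R (y $ i div int N))))"

lemma cell_in_grid: "R \<ge> 0 \<Longrightarrow> cell R N y \<in> grid R"
  by (auto simp: grid_def cell_def)

text \<open>Adding \<open>N * v\<close> shifts the integer quotients by exactly \<open>v\<close>,
  and clamping does not increase distances.\<close>

lemma infnorm_cell_step: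
  assumes "N > 0" "v \<in> unit_box"
  shows "infnorm (cell R N (y + of_nat N * v) - cell R N y :: real ^ 'n) \<le> 1"
proof -
  have "\<bar>(cell R N (y + of_nat N * v) - cell R N y :: real ^ 'n) $ i\<bar> \<le> 1" for i
  proof -
    have "v $ i \<in> {-1, 0, 1}"
      using assms(2) by (simp add: unit_box_def)
    moreover have "(y + of_nat N * v) $ i div int N = y $ i div int N + v $ i"
      using assms(1) by (simp add: of_nat_index)
    ultimately show ?thesis
      by (auto simp: cell_def)
  qed
  then show ?thesis
    by (simp add: infnorm_eq_Max_cart)
qed

text \<open>This is a discrete partial derivative at 0. The factor \<open>N\<close> is the side of a
  cell, so slopes are measured in the units of \<open>f\<close>.\<close>

definition diff_fun :: "(int ^ 'n) list \<Rightarrow> int \<Rightarrow> nat \<Rightarrow> 'n \<Rightarrow> (real ^ 'n \<Rightarrow> real) \<Rightarrow> real" where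
  "diff_fun vs R N i f = real N *
     (avg N vs (\<lambda>y. f (cell R N y)) (axis i 1) - avg N vs (\<lambda>y. f (cell R N y)) 0)"

text \<open>Expanding \<open>f\<close> on the box in indicators of points gives a combination of
  evaluations whose index set is the same for every \<open>N\<close>; this makes a limit in
  \<open>N\<close> possible.\<close>

lemma diff_fun_eq_sum:
  fixes f :: "real ^ 'n \<Rightarrow> real"
  assumes "R \<ge> 0"
  shows "diff_fun vs R N i f = (\<Sum>k\<in>grid R. diff_fun vs R N i (\<lambda>x. of_bool (x = k)) * f k)"
proof -
  have "f (cell R N y) = (\<Sum>k\<in>grid R. f k * of_bool (cell R N y = k))" for y :: "int ^ 'n"
  proof -
    have "(\<Sum>k\<in>grid R. f k * of_bool (cell R N y = k)) = (\<Sum>k\<in>grid R. if cell R N y = k then f k else 0)"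
      by (intro sum.cong) auto
    also have "\<dots> = f (cell R N y)"
      by (simp only: sum.delta'[OF finite_grid] cell_in_grid[OF assms] if_True)
    finally show ?thesis by (rule sym)
  qed
  then have "avg N vs (\<lambda>y. f (cell R N y)) x
      = (\<Sum>k\<in>grid R. f k * avg N vs (\<lambda>y. of_bool (cell R N y = k)) x)" for x
    by (simp add: avg_sum avg_cmult)
  then show ?thesis
    by (simp add: diff_fun_def sum_distrib_left right_diff_distrib sum_subtractf mult_ac)
qed

text \<open>Applied to indicators of points, this bounds the coefficients uniformly in
  \<open>N\<close>.\<close>

lemma diff_fun_bound:
  assumes "N > 0" "axis i 1 \<in> set vs" "\<And>x y. \<bar>f x - f y\<bar> \<le> 1"
  shows "\<bar>diff_fun vs R N i f\<bar> \<le> 1"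
  using avg_step_bound[OF assms(1,2), of "\<lambda>y. f (cell R N y)" 1 0] assms(1,3)
  by (simp add: diff_fun_def abs_mult pos_le_divide_eq mult.commute)

lemma diff_fun_coordinate:
  fixes vs :: "(int ^ 'n) list"
  assumes N: "N > 0" and vs: "set vs \<subseteq> unit_box" "axis i 1 \<in> set vs" and R: "int (length vs) + 1 \<le> R"
  shows "diff_fun vs R N i (\<lambda>x. x $ i) = 1"
proof -
  let ?g = "\<lambda>y :: int ^ 'n. real_of_int (y $ i div int N)"
  \<comment> \<open>The averages at 0 and \<open>axis i 1\<close> only reach points with
    \<open>i\<close>-th coordinate at most \<open>N * length vs + 1 \<le> N * R\<close> in absolute
    value, where the clamp does nothing to that coordinate.\<close>
  have near: "avg N vs (\<lambda>y. cell R N y $ i) x = avg N vs ?g x" if x: "\<bar>x $ i\<bar> \<le> 1" for x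
  proof (rule avg_cong_near)
    show "\<bar>v $ j\<bar> \<le> 1" if "v \<in> set vs" for v j
    proof -
      have "v $ j \<in> {-1, 0, 1}"
        using that vs(1) unfolding unit_box_def by blast
      then show ?thesis by auto
    qed
    fix y :: "int ^ 'n"
    assume "\<And>j. \<bar>y $ j - x $ j\<bar> \<le> int N * int (length vs)"
    from this[of i] x have "\<bar>y $ i\<bar> \<le> int N * int (length vs) + 1"
      by linarith
    also have "\<dots> \<le> int N * (int (length vs) + 1)"
      using N by (simp add: algebra_simps)
    also have "\<dots> \<le> int N * R"
      using R by (intro mult_left_mono) auto
    finally have y: "\<bar>y $ i\<bar> \<le> int N * R" .
    then have "y $ i div int N \<le> R"
      using N zdiv_mono1[of "y $ i" "int N * R" "int N"] by simp
    moreover have "int N * (- R) div int N \<le> y $ i div int N"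
      using N y by (intro zdiv_mono1) auto
    then have "- R \<le> y $ i div int N"
      using N by (simp del: mult_minus_right)
    ultimately show "cell R N y $ i = ?g y"
      by (simp add: cell_def)
  qed
  have "?g (y + of_nat N * axis i 1) - ?g y = 1" for y
    using N by (simp add: of_nat_index axis_def)
  then have "avg N vs ?g (0 + axis i 1) - avg N vs ?g 0 = 1 / real N"
    by (simp only: avg_step[OF vs(2)] avg_const[OF N])
  then show ?thesis
    using N near[of "axis i 1"] near[of 0] by (simp add: diff_fun_def axis_def)
qed

text \<open>Inserting the signs \<open>s\<close> makes the sum of absolute values linear. By almost
  linearity it is close to \<open>N * (F q - F 0)\<close>, and the sign vector \<open>q\<close> is
  itself a direction, so this is at most 1. The error is \<open>N\<close> times \<open>n\<close>
  mixed differences of size at most \<open>2 / N\<^sup>2\<close>, with \<open>n\<close> the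
  dimension.\<close>

lemma sum_diff_fun_bound:
  fixes f :: "real ^ 'n \<Rightarrow> real"
  assumes N: "N > 0" and R: "R \<ge> 0"
    and vs: "\<And>v. v \<in> unit_box \<Longrightarrow> v \<in> set vs"
      "\<And>v w. v \<in> unit_box \<Longrightarrow> w \<in> unit_box \<Longrightarrow> w \<in> set (remove1 v vs)"
    and f: "\<And>x y. x \<in> grid R \<Longrightarrow> y \<in> grid R \<Longrightarrow> \<bar>f x - f y\<bar> \<le> infnorm (x - y)"
  shows "(\<Sum>i\<in>UNIV. \<bar>diff_fun vs R N i f\<bar>) \<le> 1 + 2 * real CARD('n) / real N"
proof -
  define F where "F = avg N vs (\<lambda>y. f (cell R N y))"
  define s where "s i = (if diff_fun vs R N i f < 0 then - 1 else 1 :: int)" for i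
  define q :: "int ^ 'n" where "q = (\<chi> j. s j)"
  have q: "q \<in> unit_box"
    by (simp add: q_def s_def unit_box_def)
  have g: "\<bar>f (cell R N (y + of_nat N * v)) - f (cell R N y)\<bar> \<le> 1" if "v \<in> unit_box" for v y
    using f[OF cell_in_grid[OF R] cell_in_grid[OF R]] infnorm_cell_step[OF N that]
    by (rule order_trans)
  have "\<bar>(F (x + w + v) - F (x + w)) - (F (x + v) - F x)\<bar> \<le> 2 / (real N)\<^sup>2"
    if "v \<in> unit_box" "w \<in> unit_box" for v w x
    using avg_second_step_bound[OF N vs(1)[OF that(1)] vs(2)[OF that], of "\<lambda>y. f (cell R N y)" 1 x] g that
    by (simp add: F_def)
  from almost_linear[where F = F and s = s and S = UNIV, OF this]
  have lin: "\<bar>F q - F 0 - (\<Sum>i\<in>UNIV. of_int (s i) * (F (axis i 1) - F 0))\<bar>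
      \<le> real CARD('n) * (2 / (real N)\<^sup>2)"
    by (simp add: q_def s_def)
  have Fq: "\<bar>F q - F 0\<bar> \<le> 1 / real N"
    using avg_step_bound[OF N vs(1)[OF q], of "\<lambda>y. f (cell R N y)" 1 0] g[OF q]
    by (simp add: F_def)
  have "(\<Sum>i\<in>UNIV. \<bar>diff_fun vs R N i f\<bar>) = (\<Sum>i\<in>UNIV. of_int (s i) * diff_fun vs R N i f)"
    by (intro sum.cong) (auto simp: s_def)
  also have "\<dots> = real N * (\<Sum>i\<in>UNIV. of_int (s i) * (F (axis i 1) - F 0))"
    by (simp add: diff_fun_def F_def sum_distrib_left mult_ac)
  also have "\<dots> \<le> real N * (1 / real N + real CARD('n) * (2 / (real N)\<^sup>2))"
    using lin Fq by (intro mult_left_mono) linarith+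
  also have "\<dots> = 1 + 2 * real CARD('n) / real N"
    using N by (simp add: field_simps power2_eq_square)
  finally show ?thesis .
qed

section \<open>Passing to the limit\<close>

lemma finite_pointwise_convergent_subsequence:
  fixes c :: "nat \<Rightarrow> 'a \<Rightarrow> real"
  assumes "finite S" "\<And>n s. s \<in> S \<Longrightarrow> \<bar>c n s\<bar> \<le> B"
  shows "\<exists>r l. strict_mono r \<and> (\<forall>s\<in>S. (\<lambda>n. c (r n) s) \<longlonglongrightarrow> l s)"
  using assms
proof (induction S rule: finite_induct)
  case empty
  then show ?case
    by (auto intro: exI[of _ id] simp: strict_mono_def)
next
  case (insert a S)
  then obtain r l where r: "strict_mono r" and l: "\<And>s. s \<in> S \<Longrightarrow> (\<lambda>n. c (r n) s) \<longlonglongrightarrow> l s"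
    by (metis insert_iff)
  have "bounded (range (\<lambda>n. c (r n) a))"
    using insert.prems by (auto simp: bounded_iff)
  then obtain b r' where r': "strict_mono r'" and b: "((\<lambda>n. c (r n) a) \<circ> r') \<longlonglongrightarrow> b"
    using bounded_imp_convergent_subsequence by blast
  have "(\<lambda>n. c ((r \<circ> r') n) s) \<longlonglongrightarrow> (l(a := b)) s" if "s \<in> insert a S" for s
    using that insert.hyps b LIMSEQ_subseq_LIMSEQ[OF l r'] by (auto simp: o_def)
  then show ?case
    using strict_mono_o[OF r r'] by blast
qed

lemma exists_l1_functionals:
  "\<exists>R c. R \<ge> 0 \<and>
     (\<forall>f. (\<forall>x\<in>grid R. \<forall>y\<in>grid R. \<bar>f x - f y\<bar> \<le> infnorm (x - y)) \<longrightarrow>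
       (\<Sum>i\<in>UNIV. \<bar>\<Sum>k\<in>grid R. c i k * f k\<bar>) \<le> 1) \<and>
     (\<forall>i :: 'n::finite. (\<Sum>k\<in>grid R. c i k * k $ i) = (1 :: real))"
proof -
  obtain us where us: "set us = (unit_box :: (int ^ 'n) set)"
    using finite_list[OF finite_unit_box] by blast
  \<comment> \<open>With two copies of each direction, removing one still leaves all of
    \<open>unit_box\<close>, as the second-difference bound requires.\<close>
  define vs where "vs = us @ us"
  have vs: "set vs = unit_box" "\<And>v w. v \<in> unit_box \<Longrightarrow> w \<in> unit_box \<Longrightarrow> w \<in> set (remove1 v vs)"
    using us by (auto simp: vs_def remove1_append)
  define R where "R = int (length vs) + 1"
  have R: "R \<ge> 0"
    by (simp add: R_def)
  \<comment> \<open>\<open>Suc n\<close> keeps the averaging length positive.\<close>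
  define c where "c n p = diff_fun vs R (Suc n) (fst p) (\<lambda>x. of_bool (x = snd p))" for n p
  have "\<bar>c n p\<bar> \<le> 1" for n p
    unfolding c_def by (rule diff_fun_bound) (auto simp: vs axis_in_unit_box)
  moreover have "finite (UNIV \<times> grid R :: ('n \<times> (real ^ 'n)) set)"
    by (simp add: finite_grid)
  ultimately obtain r l where r: "strict_mono r"
    and l: "\<And>p. p \<in> UNIV \<times> grid R \<Longrightarrow> (\<lambda>n. c (r n) p) \<longlonglongrightarrow> l p"
    using finite_pointwise_convergent_subsequence[of "UNIV \<times> grid R" c 1] by blast
  have lim: "(\<lambda>n. diff_fun vs R (Suc (r n)) i f) \<longlonglongrightarrow> (\<Sum>k\<in>grid R. l (i, k) * f k)" for i f
    unfolding diff_fun_eq_sum[OF R, of vs _ i f]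
    using l by (intro tendsto_sum tendsto_mult_right) (auto simp: c_def)
  have "(\<Sum>i\<in>UNIV. \<bar>\<Sum>k\<in>grid R. l (i, k) * f k\<bar>) \<le> 1"
    if f: "\<And>x y. x \<in> grid R \<Longrightarrow> y \<in> grid R \<Longrightarrow> \<bar>f x - f y\<bar> \<le> infnorm (x - y)" for f
  proof (rule LIMSEQ_le)
    show "(\<lambda>n. \<Sum>i\<in>UNIV. \<bar>diff_fun vs R (Suc (r n)) i f\<bar>)
        \<longlonglongrightarrow> (\<Sum>i\<in>UNIV. \<bar>\<Sum>k\<in>grid R. l (i, k) * f k\<bar>)"
      by (intro tendsto_sum tendsto_rabs lim)
    have "(\<lambda>n. 1 + 2 * real CARD('n) / real (Suc n)) \<longlonglongrightarrow> 1 + 0"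
      by (intro tendsto_add tendsto_const LIMSEQ_Suc lim_const_over_n)
    from LIMSEQ_subseq_LIMSEQ[OF this r]
    show "(\<lambda>n. 1 + 2 * real CARD('n) / real (Suc (r n))) \<longlonglongrightarrow> 1"
      by (simp add: o_def)
    show "\<exists>N. \<forall>n\<ge>N. (\<Sum>i\<in>UNIV. \<bar>diff_fun vs R (Suc (r n)) i f\<bar>)
        \<le> 1 + 2 * real CARD('n) / real (Suc (r n))"
      using sum_diff_fun_bound[OF _ R, where f = f, OF _ _ vs(2) f] vs(1) by blast
  qed
  moreover have "(\<Sum>k\<in>grid R. l (i, k) * k $ i) = 1" for i
  proof -
    have "diff_fun vs R (Suc (r n)) i (\<lambda>x. x $ i) = 1" for n
      by (rule diff_fun_coordinate) (auto simp: vs R_def axis_in_unit_box)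
    with lim[of i "\<lambda>x. x $ i"] show ?thesis
      by (simp add: LIMSEQ_const_iff)
  qed
  ultimately show ?thesis
    using R by (intro exI[of _ R] exI[of _ "\<lambda>i k. l (i, k)"]) blast
qed

section \<open>Free spaces\<close>

lemma mdist_pos: "x \<in> mspace m \<Longrightarrow> y \<in> mspace m \<Longrightarrow> x \<noteq> y \<Longrightarrow> 0 < mdist m x y"
  by (metis mdist_nonneg mdist_zero order_less_le)

lemma lip_norm_bound:
  assumes "f \<in> Lip0 m z" "x \<in> mspace m" "y \<in> mspace m"
  shows "\<bar>f x - f y\<bar> \<le> lip_norm m f * mdist m x y"
proof (cases "x = y")
  case False
  let ?A = "{\<bar>f x - f y\<bar> / mdist m x y | x y. x \<in> mspace m \<and> y \<in> mspace m \<and> x \<noteq> y}"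
  obtain B where B: "\<And>x y. x \<in> mspace m \<Longrightarrow> y \<in> mspace m \<Longrightarrow> \<bar>f x - f y\<bar> \<le> B * mdist m x y"
    using assms(1) by (auto simp: Lip0_def Lipschitz_continuous_map_def dist_real_def)
  \<comment> \<open>The absolute value also covers the inserted 0, as the sign of \<open>B\<close>
    is not given.\<close>
  have "b \<le> \<bar>B\<bar>" if bA: "b \<in> insert 0 ?A" for b
  proof (cases "b = 0")
    case False
    then obtain x y where xy: "x \<in> mspace m" "y \<in> mspace m" "x \<noteq> y" and b: "b = \<bar>f x - f y\<bar> / mdist m x y"
      using bA by blast
    have "b \<le> B"
      using B[OF xy(1,2)] mdist_pos[OF xy] by (simp add: b pos_divide_le_eq)
    then show ?thesis by simp
  qed simp
  then have "bdd_above (insert 0 ?A)"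
    by (rule bdd_aboveI)
  then have "\<bar>f x - f y\<bar> / mdist m x y \<le> lip_norm m f"
    unfolding lip_norm_def using False assms(2,3) by (intro cSup_upper) auto
  then show ?thesis
    using mdist_pos[OF assms(2,3) False] by (simp add: pos_divide_le_eq)
next
  case True
  then have "mdist m x y = 0"
    using assms by simp
  then show ?thesis
    using True by simp
qed

lemma Lip0_lip_norm_le:
  assumes "\<And>x y. x \<in> mspace m \<Longrightarrow> y \<in> mspace m \<Longrightarrow> \<bar>f x - f y\<bar> \<le> C * mdist m x y"
    and "C \<ge> 0" "f z = 0" "\<And>x. x \<notin> mspace m \<Longrightarrow> f x = 0"
  shows "f \<in> Lip0 m z" "lip_norm m f \<le> C"
proof -
  show "f \<in> Lip0 m z"
    using assms by (auto simp: Lip0_def Lipschitz_continuous_map_def dist_real_def)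
  have "\<bar>f x - f y\<bar> / mdist m x y \<le> C" if "x \<in> mspace m" "y \<in> mspace m" "x \<noteq> y" for x y
    using assms(1)[OF that(1,2)] mdist_pos[OF that] by (simp add: pos_divide_le_eq)
  then show "lip_norm m f \<le> C"
    unfolding lip_norm_def using assms(2) by (intro cSup_least) auto
qed

lemma Lip0_add:
  assumes "f \<in> Lip0 m z" "g \<in> Lip0 m z"
  shows "f + g \<in> Lip0 m z"
proof (rule Lip0_lip_norm_le(1))
  fix x y assume xy: "x \<in> mspace m" "y \<in> mspace m"
  have "\<bar>(f + g) x - (f + g) y\<bar> \<le> \<bar>f x - f y\<bar> + \<bar>g x - g y\<bar>"
    by simp
  also have "\<dots> \<le> lip_norm m f * mdist m x y + lip_norm m g * mdist m x y"
    using lip_norm_bound[OF assms(1) xy] lip_norm_bound[OF assms(2) xy] by linarith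
  \<comment> \<open>The absolute value supplies a nonnegative constant without a separate argument
    about the sign of \<open>lip_norm\<close>.\<close>
  also have "\<dots> \<le> \<bar>lip_norm m f + lip_norm m g\<bar> * mdist m x y"
    by (simp add: mult_right_mono flip: distrib_right)
  finally show "\<bar>(f + g) x - (f + g) y\<bar> \<le> \<bar>lip_norm m f + lip_norm m g\<bar> * mdist m x y" .
qed (use assms in \<open>auto simp: Lip0_def\<close>)

lemma Lip0_scaleR:
  assumes "f \<in> Lip0 m z"
  shows "c *\<^sub>R f \<in> Lip0 m z"
proof (rule Lip0_lip_norm_le(1))
  fix x y assume xy: "x \<in> mspace m" "y \<in> mspace m"
  have "\<bar>(c *\<^sub>R f) x - (c *\<^sub>R f) y\<bar> = \<bar>c\<bar> * \<bar>f x - f y\<bar>"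
    by (simp flip: right_diff_distrib abs_mult)
  also have "\<dots> \<le> \<bar>c\<bar> * (lip_norm m f * mdist m x y)"
    by (intro mult_left_mono lip_norm_bound[OF assms xy]) simp
  also have "\<dots> \<le> \<bar>c * lip_norm m f\<bar> * mdist m x y"
    by (simp add: abs_mult mult.assoc mult_left_mono mult_right_mono)
  finally show "\<bar>(c *\<^sub>R f) x - (c *\<^sub>R f) y\<bar> \<le> \<bar>c * lip_norm m f\<bar> * mdist m x y" .
qed (use assms in \<open>auto simp: Lip0_def\<close>)

lemma zero_in_Lip0_ball: "0 \<in> Lip0 m z \<and> lip_norm m 0 \<le> 1"
  using Lip0_lip_norm_le[of m 0 1 z] by simp

lemma subspace_Lip0_dual: "subspace (Lip0_dual m z)"
proof (rule subspaceI)
  show "0 \<in> Lip0_dual m z"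
    by (auto simp: Lip0_dual_def intro: exI[of _ 0])
next
  fix \<phi> \<psi> assume \<phi>: "\<phi> \<in> Lip0_dual m z" and \<psi>: "\<psi> \<in> Lip0_dual m z"
  obtain C D where "\<forall>f\<in>Lip0 m z. \<bar>\<phi> f\<bar> \<le> C * lip_norm m f" "\<forall>f\<in>Lip0 m z. \<bar>\<psi> f\<bar> \<le> D * lip_norm m f"
    using \<phi> \<psi> by (auto simp: Lip0_dual_def)
  then have "\<forall>f\<in>Lip0 m z. \<bar>(\<phi> + \<psi>) f\<bar> \<le> (C + D) * lip_norm m f"
    by (fastforce simp: distrib_right intro: order_trans[OF abs_triangle_ineq] add_mono)
  then have "\<exists>C. \<forall>f\<in>Lip0 m z. \<bar>(\<phi> + \<psi>) f\<bar> \<le> C * lip_norm m f"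
    by (rule exI)
  then show "\<phi> + \<psi> \<in> Lip0_dual m z"
    using \<phi> \<psi> by (simp add: Lip0_dual_def distrib_left)
next
  fix c \<phi> assume \<phi>: "\<phi> \<in> Lip0_dual m z"
  obtain C where "\<forall>f\<in>Lip0 m z. \<bar>\<phi> f\<bar> \<le> C * lip_norm m f"
    using \<phi> by (auto simp: Lip0_dual_def)
  then have "\<forall>f\<in>Lip0 m z. \<bar>(c *\<^sub>R \<phi>) f\<bar> \<le> \<bar>c\<bar> * C * lip_norm m f"
    by (auto simp: abs_mult mult.assoc intro: mult_left_mono)
  then have "\<exists>C. \<forall>f\<in>Lip0 m z. \<bar>(c *\<^sub>R \<phi>) f\<bar> \<le> C * lip_norm m f"
    by (rule exI)
  then show "c *\<^sub>R \<phi> \<in> Lip0_dual m z"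
    using \<phi> by (simp add: Lip0_dual_def distrib_left mult.left_commute)
qed

lemma eval_functional_in_Lip0_dual:
  assumes "x \<in> mspace m" "z \<in> mspace m"
  shows "eval_functional m z x \<in> Lip0_dual m z"
proof -
  have "\<forall>f\<in>Lip0 m z. \<bar>eval_functional m z x f\<bar> \<le> mdist m x z * lip_norm m f"
    using lip_norm_bound[OF _ assms, of _ z] by (auto simp: eval_functional_def Lip0_def mult.commute)
  then show ?thesis
    by (auto simp: Lip0_dual_def eval_functional_def Lip0_add Lip0_scaleR)
qed

lemma dual_norm_zero: "dual_norm m z 0 = 0"
proof -
  have "{\<bar>0 f :: real\<bar> | f. f \<in> Lip0 m z \<and> lip_norm m f \<le> 1} = {0}"
    using zero_in_Lip0_ball[of m z] by auto
  then show ?thesis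
    by (simp add: dual_norm_def)
qed

lemma span_eval_subset_free_space:
  assumes "z \<in> mspace m"
  shows "span (eval_functional m z ` mspace m) \<subseteq> free_space m z"
proof
  fix \<mu> assume \<mu>: "\<mu> \<in> span (eval_functional m z ` mspace m)"
  have "span (eval_functional m z ` mspace m) \<subseteq> Lip0_dual m z"
    using eval_functional_in_Lip0_dual[OF _ assms] by (intro span_minimal subspace_Lip0_dual) auto
  then show "\<mu> \<in> free_space m z"
    using \<mu> by (auto simp: free_space_def dual_norm_zero intro!: bexI[of _ \<mu>])
qed

lemma sum_fun_apply: "(\<Sum>i\<in>A. f i) x = (\<Sum>i\<in>A. f i x)"
  by (induction A rule: infinite_finite_induct) auto

lemma dual_norm_l1:
  fixes u :: "'n::finite \<Rightarrow> ('a \<Rightarrow> real) \<Rightarrow> real"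
  assumes u: "\<And>f. f \<in> Lip0 m z \<Longrightarrow> lip_norm m f \<le> 1 \<Longrightarrow> (\<Sum>i\<in>UNIV. \<bar>u i f\<bar>) \<le> 1"
    and e: "\<And>i. e i \<in> Lip0 m z" "\<And>i. lip_norm m (e i) \<le> 1" "\<And>i. u i (e i) = 1"
  shows "dual_norm m z (\<Sum>i\<in>UNIV. t i *\<^sub>R u i) = Max (range (\<lambda>i. \<bar>t i\<bar>))"
proof (rule antisym)
  let ?B = "{\<bar>(\<Sum>i\<in>UNIV. t i *\<^sub>R u i) f\<bar> | f. f \<in> Lip0 m z \<and> lip_norm m f \<le> 1}"
  let ?t = "Max (range (\<lambda>i. \<bar>t i\<bar>))"
  have t: "\<bar>t i\<bar> \<le> ?t" for i
    by (rule Max_ge) auto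
  then have "?t \<ge> 0"
    using abs_ge_zero order_trans by blast
  have le: "b \<le> ?t" if bB: "b \<in> ?B" for b
  proof -
    obtain f where f: "f \<in> Lip0 m z" "lip_norm m f \<le> 1" and b: "b = \<bar>\<Sum>i\<in>UNIV. t i * u i f\<bar>"
      using bB unfolding sum_fun_apply scaleR_fun_apply real_scaleR_def by blast
    have "b \<le> (\<Sum>i\<in>UNIV. \<bar>t i\<bar> * \<bar>u i f\<bar>)"
      unfolding b abs_mult[symmetric] by (rule sum_abs)
    also have "\<dots> \<le> (\<Sum>i\<in>UNIV. ?t * \<bar>u i f\<bar>)"
      by (intro sum_mono mult_right_mono t) auto
    also have "\<dots> \<le> ?t * 1"
      using u[OF f] \<open>?t \<ge> 0\<close> unfolding sum_distrib_left[symmetric] by (rule mult_left_mono)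
    finally show ?thesis by simp
  qed
  have "?B \<noteq> {}"
    using e(1,2) by blast
  then show "dual_norm m z (\<Sum>i\<in>UNIV. t i *\<^sub>R u i) \<le> ?t"
    unfolding dual_norm_def using le by (rule cSup_least)
  have "?t \<in> range (\<lambda>i. \<bar>t i\<bar>)"
    by (rule Max_in) auto
  then obtain i where i: "?t = \<bar>t i\<bar>"
    by blast
  \<comment> \<open>The value 1 at index \<open>i\<close> uses up the whole l1 bound, so the other
    functionals vanish on \<open>e i\<close>.\<close>
  have "(\<Sum>j\<in>UNIV. \<bar>u j (e i)\<bar>) = 1 + (\<Sum>j\<in>UNIV - {i}. \<bar>u j (e i)\<bar>)"
    using sum.remove[of UNIV i "\<lambda>j. \<bar>u j (e i)\<bar>"] e(3) by simp
  with u[OF e(1,2)] have "(\<Sum>j\<in>UNIV - {i}. \<bar>u j (e i)\<bar>) \<le> 0"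
    by (metis add_le_same_cancel1)
  then have "(\<Sum>j\<in>UNIV - {i}. \<bar>u j (e i)\<bar>) = 0"
    by (intro antisym sum_nonneg) auto
  then have "u j (e i) = 0" if "j \<noteq> i" for j
    using that by (subst (asm) sum_nonneg_eq_0_iff) auto
  then have "(\<Sum>j\<in>UNIV. t j * u j (e i)) = t i"
    using sum.remove[of UNIV i "\<lambda>j. t j * u j (e i)"] e(3) by simp
  then have "?t \<in> ?B"
    using e(1,2)[of i] i by (auto simp: sum_fun_apply intro!: exI[of _ "e i"])
  then show "?t \<le> dual_norm m z (\<Sum>i\<in>UNIV. t i *\<^sub>R u i)"
    unfolding dual_norm_def using le by (intro cSup_upper bdd_aboveI)
qed

theorem mainTheorem1:
  shows "\<exists>M :: (real ^ 'n) set.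
           finite M \<and> (\<forall>x\<in>M. \<forall>i. x $ i \<in> \<int>) \<and> 0 \<in> M \<and>
           contains_isometric_copy (infnorm :: real ^ 'n \<Rightarrow> real)
             (free_space (submetric linf_metric M) 0) (dual_norm (submetric linf_metric M) 0) \<and>
           (\<exists>u :: 'n \<Rightarrow> (real ^ 'n \<Rightarrow> real) \<Rightarrow> real.
              (\<forall>i. u i \<in> free_space (submetric linf_metric M) 0) \<and>
              (\<forall>t :: 'n \<Rightarrow> real.
                 dual_norm (submetric linf_metric M) 0 (\<Sum>i\<in>UNIV. t i *\<^sub>R u i)
                   = Max (range (\<lambda>i. \<bar>t i\<bar>))))"
proof -
  obtain R and c :: "'n \<Rightarrow> real ^ 'n \<Rightarrow> real" where Rc: "R \<ge> 0 \<and>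
     (\<forall>f. (\<forall>x\<in>grid R. \<forall>y\<in>grid R. \<bar>f x - f y\<bar> \<le> infnorm (x - y)) \<longrightarrow>
       (\<Sum>i\<in>UNIV. \<bar>\<Sum>k\<in>grid R. c i k * f k\<bar>) \<le> 1) \<and>
     (\<forall>i. (\<Sum>k\<in>grid R. c i k * k $ i) = 1)"
    using exists_l1_functionals[where 'n = 'n] by (elim exE) (rule that)
  define M :: "(real ^ 'n) set" where "M = grid R"
  define m where "m = submetric linf_metric M"
  have m: "mspace m = M" "mdist m = (\<lambda>x y. infnorm (x - y))"
    by (auto simp: m_def fun_eq_iff)
  have M: "finite M" "0 \<in> M"
    using Rc by (simp_all add: M_def finite_grid zero_in_grid)
  define u where "u i = (\<Sum>k\<in>M. c i k *\<^sub>R eval_functional m 0 k)" for i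
  \<comment> \<open>Coordinate functions, cut off to 0 outside \<open>M\<close> because elements of
    \<open>Lip0\<close> vanish there.\<close>
  define e :: "'n \<Rightarrow> real ^ 'n \<Rightarrow> real" where "e i x = (if x \<in> M then x $ i else 0)" for i x
  have u_eq: "u i f = (\<Sum>k\<in>M. c i k * f k)" if "f \<in> Lip0 m 0" for i f
    using that by (simp add: u_def sum_fun_apply eval_functional_def)
  have e: "e i \<in> Lip0 m 0" "lip_norm m (e i) \<le> 1" for i
  proof -
    have "\<bar>e i x - e i y\<bar> \<le> 1 * mdist m x y" if "x \<in> mspace m" "y \<in> mspace m" for x y
      using that component_le_infnorm_cart[of "x - y" i] by (simp add: m e_def)
    then show "e i \<in> Lip0 m 0" "lip_norm m (e i) \<le> 1"
      by (rule Lip0_lip_norm_le[where z = 0 and C = 1]; simp add: m e_def)+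
  qed
  have ue: "u i (e i) = 1" for i
    using Rc e(1)[of i] by (simp add: u_eq e_def M_def)
  have u1: "(\<Sum>i\<in>UNIV. \<bar>u i f\<bar>) \<le> 1" if f: "f \<in> Lip0 m 0" "lip_norm m f \<le> 1" for f
  proof -
    have "\<bar>f x - f y\<bar> \<le> infnorm (x - y)" if "x \<in> M" "y \<in> M" for x y
    proof -
      have "\<bar>f x - f y\<bar> \<le> lip_norm m f * infnorm (x - y)"
        using lip_norm_bound[OF f(1)] that by (simp add: m)
      also have "\<dots> \<le> 1 * infnorm (x - y)"
        using f(2) by (intro mult_right_mono infnorm_pos_le)
      finally show ?thesis by simp
    qed
    then show ?thesis
      using Rc by (simp add: u_eq f M_def)
  qed
  have norm_u: "dual_norm m 0 (\<Sum>i\<in>UNIV. t i *\<^sub>R u i) = Max (range (\<lambda>i. \<bar>t i\<bar>))" for t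
    by (rule dual_norm_l1[where e = e]) (fact u1 e ue)+
  have u_span: "u i \<in> span (eval_functional m 0 ` mspace m)" for i
    unfolding u_def m by (intro span_sum span_scale span_base imageI)
  have free: "span (eval_functional m 0 ` mspace m) \<subseteq> free_space m 0"
    using M by (intro span_eval_subset_free_space) (simp add: m)
  have "contains_isometric_copy (infnorm :: real ^ 'n \<Rightarrow> real) (free_space m 0) (dual_norm m 0)"
    unfolding contains_isometric_copy_def
  proof (intro exI conjI allI)
    show "linear (\<lambda>x. \<Sum>i\<in>UNIV. (x $ i) *\<^sub>R u i)"
      by (rule linearI) (simp_all add: scaleR_add_left sum.distrib scaleR_sum_right)
    show "range (\<lambda>x :: real ^ 'n. \<Sum>i\<in>UNIV. (x $ i) *\<^sub>R u i) \<subseteq> free_space m 0"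
      using free by (auto intro!: subsetD[OF free] span_sum span_scale u_span)
    show "dual_norm m 0 (\<Sum>i\<in>UNIV. (x $ i) *\<^sub>R u i) = infnorm x" for x :: "real ^ 'n"
      unfolding norm_u infnorm_eq_Max_cart ..
  qed
  moreover have "\<forall>x\<in>M. \<forall>i. x $ i \<in> \<int>"
    unfolding M_def grid_def Ints_def by blast
  ultimately show ?thesis
    using M norm_u u_span free unfolding m_def by (intro exI[of _ M]) blast
qed

end
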